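(* Let $\varsigma\in\mathcal{S}_p(v,0)$ be a prime substitution and $d\ge0$. Then: (a) for every level-$d$ minterm $\mu$ (in $v$ variables), $\mu\circ\varsigma$ is $\approx$ to a single level-$d$ minterm, and the resulting map $f_\varsigma(\mu)=\mu\circ\varsigma$ is a bijection of the set of level-$d$ minterms; (b) the map $f_\varsigma:\mathbf{E}[v,d]\to\mathbf{E}[v,d]$, $f_\varsigma(\varphi)=\varphi\circ\varsigma$, is a lattice automorphism.
   Context: Language: variables $p_1,p_2,\dots$, constants $0,1$, connectives $\neg,\vee,\wedge$, modal operator $\lozenge$. $\mathbf{E}$ is the smallest set of formulas containing all tautologies and closed under modus ponens, uniform substitution and RE (from $\varphi\leftrightarrow\psi$ infer $\lozenge\varphi\leftrightarrow\lozenge\psi$). $\varphi\approx\psi$ means $\vdash_{\mathbf{E}}\varphi\leftrightarrow\psi$. $\mathcal{F}(v,d)$: formulas in $p_1,\dots,p_v$ of $\lozenge$-depth $\le d$; $\mathbf{E}[v,d]=\mathcal{F}(v,d)/\approx$, a Boolean lattice. DCF minterms (fixed $v$): level-0 minterms are $\pm p_1\wedge\dots\wedge\pm p_v$; DCF formulas of $\mathcal{F}(v,0)$ are disjunctions of sets of distinct level-0 minterms; for $d\ge1$ the level-$d$ modal factors are $\lozenge\phi$ for every DCF formula $\phi$ of $\mathcal{F}(v,d-1)$, a level-$d$ minterm is a level-0 minterm conjoined with every level-$d$ modal factor, each plain or negated, and DCF formulas of $\mathcal{F}(v,d)$ are disjunctions of sets of distinct level-$d$ minterms. Every formula of $\mathcal{F}(v,d)$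 is $\approx$ to a unique DCF formula. Substitutions: a level-0 substitution is a tuple $\sigma=(\sigma_1,\dots,\sigma_v)$ of non-modal formulas in $p_1,\dots,p_v$ (up to $\approx$); $\varphi\circ\sigma$ replaces every $p_i$ in $\varphi$ (including inside $\lozenge$) by $\sigma_i$. Under composition $(\sigma\sigma')_i=\sigma_i(\sigma'_1,\dots,\sigma'_v)$ these form a monoid $\mathcal{S}(v,0)$; prime substitutions are its invertible elements, forming the group $\mathcal{S}_p(v,0)$. *)

theory Defs
  imports "HOL-Algebra.Group"
begin

section \<open>Language and logic\<close>

text \<open>\<open>Var i\<close> is the variable \<open>p\<^sub>i\<^sub>+\<^sub>1\<close>; the variables \<open>p\<^sub>1, \<dots>, p\<^sub>v\<close> are those with index below \<open>v\<close>.\<close>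

datatype fm = Var nat | Bot | Top | Neg fm | Or fm fm | And fm fm | Dia fm

abbreviation Imp :: "fm \<Rightarrow> fm \<Rightarrow> fm" where
  "Imp \<phi> \<psi> \<equiv> Or (Neg \<phi>) \<psi>"

abbreviation Iff :: "fm \<Rightarrow> fm \<Rightarrow> fm" where
  "Iff \<phi> \<psi> \<equiv> And (Imp \<phi> \<psi>) (Imp \<psi> \<phi>)"

primrec vars :: "fm \<Rightarrow> nat set" where
  "vars (Var i) = {i}"
| "vars Bot = {}"
| "vars Top = {}"
| "vars (Neg \<phi>) = vars \<phi>"
| "vars (Or \<phi> \<psi>) = vars \<phi> \<union> vars \<psi>"
| "vars (And \<phi> \<psi>) = vars \<phi> \<union> vars \<psi>"
| "vars (Dia \<phi>) = vars \<phi>"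

primrec depth :: "fm \<Rightarrow> nat" where
  "depth (Var i) = 0"
| "depth Bot = 0"
| "depth Top = 0"
| "depth (Neg \<phi>) = depth \<phi>"
| "depth (Or \<phi> \<psi>) = max (depth \<phi>) (depth \<psi>)"
| "depth (And \<phi> \<psi>) = max (depth \<phi>) (depth \<psi>)"
| "depth (Dia \<phi>) = Suc (depth \<phi>)"

primrec subst :: "(nat \<Rightarrow> fm) \<Rightarrow> fm \<Rightarrow> fm" where
  "subst s (Var i) = s i"
| "subst s Bot = Bot"
| "subst s Top = Top"
| "subst s (Neg \<phi>) = Neg (subst s \<phi>)"
| "subst s (Or \<phi> \<psi>) = Or (subst s \<phi>) (subst s \<psi>)"
| "subst s (And \<phi> \<psi>) = And (subst s \<phi>) (subst s \<psi>)"
| "subst s (Dia \<phi>) = Dia (subst s \<phi>)"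

text \<open>Classical truth, with variables and formulas \<open>Dia \<phi>\<close> both treated as propositional atoms.\<close>

primrec ptrue :: "(fm \<Rightarrow> bool) \<Rightarrow> fm \<Rightarrow> bool" where
  "ptrue w (Var i) \<longleftrightarrow> w (Var i)"
| "ptrue w Bot \<longleftrightarrow> False"
| "ptrue w Top \<longleftrightarrow> True"
| "ptrue w (Neg \<phi>) \<longleftrightarrow> \<not> ptrue w \<phi>"
| "ptrue w (Or \<phi> \<psi>) \<longleftrightarrow> ptrue w \<phi> \<or> ptrue w \<psi>"
| "ptrue w (And \<phi> \<psi>) \<longleftrightarrow> ptrue w \<phi> \<and> ptrue w \<psi>"
| "ptrue w (Dia \<phi>) \<longleftrightarrow> w (Dia \<phi>)"

definition tautology :: "fm \<Rightarrow> bool" where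
  "tautology \<phi> \<longleftrightarrow> (\<forall>w. ptrue w \<phi>)"

inductive_set E_logic :: "fm set" where
  taut: "tautology \<phi> \<Longrightarrow> \<phi> \<in> E_logic"
| mp: "\<lbrakk>\<phi> \<in> E_logic; Imp \<phi> \<psi> \<in> E_logic\<rbrakk> \<Longrightarrow> \<psi> \<in> E_logic"
| us: "\<phi> \<in> E_logic \<Longrightarrow> subst s \<phi> \<in> E_logic"
| re: "Iff \<phi> \<psi> \<in> E_logic \<Longrightarrow> Iff (Dia \<phi>) (Dia \<psi>) \<in> E_logic"

definition fm_equiv :: "fm \<Rightarrow> fm \<Rightarrow> bool" (infix \<open>\<approx>\<^sub>E\<close> 50) where
  "\<phi> \<approx>\<^sub>E \<psi> \<longleftrightarrow> Iff \<phi> \<psi> \<in> E_logic"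

definition Fms :: "nat \<Rightarrow> nat \<Rightarrow> fm set" where
  "Fms v d = {\<phi>. vars \<phi> \<subseteq> {..<v} \<and> depth \<phi> \<le> d}"


section \<open>The Boolean lattice \<open>E[v,d]\<close>\<close>

definition Fms_rel :: "nat \<Rightarrow> nat \<Rightarrow> (fm \<times> fm) set" where
  "Fms_rel v d = {(\<phi>, \<psi>). \<phi> \<in> Fms v d \<and> \<psi> \<in> Fms v d \<and> \<phi> \<approx>\<^sub>E \<psi>}"

definition fm_class :: "nat \<Rightarrow> nat \<Rightarrow> fm \<Rightarrow> fm set" where
  "fm_class v d \<phi> = Fms_rel v d `` {\<phi>}"

text \<open>The order is provable implication; see \<open>join_E_lattice\<close> and \<open>meet_E_lattice\<close> below for
  the induced lattice operations.\<close>

definition E_lattice :: "nat \<Rightarrow> nat \<Rightarrow> fm set gorder" where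
  "E_lattice v d =
    \<lparr>carrier = Fms v d // Fms_rel v d,
     eq = (=),
     le = (\<lambda>A B. \<exists>\<phi>\<in>A. \<exists>\<psi>\<in>B. Imp \<phi> \<psi> \<in> E_logic)\<rparr>"

definition lattice_automorphism :: "('a, 'b) gorder_scheme \<Rightarrow> ('a \<Rightarrow> 'a) \<Rightarrow> bool" where
  "lattice_automorphism L f \<longleftrightarrow>
    bij_betw f (carrier L) (carrier L) \<and> join_pres L L f \<and> meet_pres L L f"


section \<open>Minterms and DCF formulas\<close>

fun conj_list :: "fm list \<Rightarrow> fm" where
  "conj_list [] = Top"
| "conj_list [\<phi>] = \<phi>"
| "conj_list (\<phi> # \<psi> # \<chi>s) = And \<phi> (conj_list (\<psi> # \<chi>s))"

fun disj_list :: "fm list \<Rightarrow> fm" where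
  "disj_list [] = Bot"
| "disj_list [\<phi>] = \<phi>"
| "disj_list (\<phi> # \<psi> # \<chi>s) = Or \<phi> (disj_list (\<psi> # \<chi>s))"

text \<open>All conjunctions in which every formula of the list occurs, plain or negated.\<close>

definition signed_conjs :: "fm list \<Rightarrow> fm list" where
  "signed_conjs \<phi>s = map conj_list (product_lists (map (\<lambda>\<phi>. [\<phi>, Neg \<phi>]) \<phi>s))"

text \<open>Minterms are kept in a duplicate-free list, whose order serves as the order of the disjuncts
  in a DCF formula; \<open>subseqs\<close> then yields one disjunction for every set of minterms.\<close>

primrec minterm_list :: "nat \<Rightarrow> nat \<Rightarrow> fm list" where
  "minterm_list v 0 = signed_conjs (map Var [0..<v])"
| "minterm_list v (Suc d) =
    signed_conjs (map Var [0..<v] @ map Dia (map disj_list (subseqs (minterm_list v d))))"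

definition minterms :: "nat \<Rightarrow> nat \<Rightarrow> fm set" where
  "minterms v d = set (minterm_list v d)"


section \<open>Level-0 substitutions\<close>

definition tup_subst :: "fm \<Rightarrow> fm list \<Rightarrow> fm" (infixl \<open>\<circ>\<^sub>s\<close> 75) where
  "\<phi> \<circ>\<^sub>s \<sigma> = subst (\<lambda>i. if i < length \<sigma> then \<sigma> ! i else Var i) \<phi>"

definition subst_tuples :: "nat \<Rightarrow> fm list set" where
  "subst_tuples v = {\<sigma>. length \<sigma> = v \<and> set \<sigma> \<subseteq> Fms v 0}"

definition subst_rel :: "nat \<Rightarrow> (fm list \<times> fm list) set" where
  "subst_rel v =
    {(\<sigma>, \<tau>). \<sigma> \<in> subst_tuples v \<and> \<tau> \<in> subst_tuples v \<and> list_all2 (\<approx>\<^sub>E) \<sigma> \<tau>}"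

definition subst_monoid :: "nat \<Rightarrow> fm list set monoid" where
  "subst_monoid v =
    \<lparr>carrier = subst_tuples v // subst_rel v,
     mult = (\<lambda>A B. \<Union>\<sigma>\<in>A. \<Union>\<tau>\<in>B. subst_rel v `` {map (\<lambda>\<phi>. \<phi> \<circ>\<^sub>s \<tau>) \<sigma>}),
     one = subst_rel v `` {map Var [0..<v]}\<rparr>"

definition prime_subst_group :: "nat \<Rightarrow> fm list set monoid" where
  "prime_subst_group v = units_of (subst_monoid v)"

text \<open>The two maps induced by a substitution. Both are stated for a representative tuple.\<close>

definition minterm_map :: "nat \<Rightarrow> nat \<Rightarrow> fm list \<Rightarrow> fm \<Rightarrow> fm" where
  "minterm_map v d \<sigma> \<mu> = (THE \<nu>. \<nu> \<in> minterms v d \<and> \<mu> \<circ>\<^sub>s \<sigma> \<approx>\<^sub>E \<nu>)"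

definition class_map :: "nat \<Rightarrow> nat \<Rightarrow> fm list \<Rightarrow> fm set \<Rightarrow> fm set" where
  "class_map v d \<sigma> A = (\<Union>\<phi>\<in>A. fm_class v d (\<phi> \<circ>\<^sub>s \<sigma>))"


section \<open>Well-definedness of the structures\<close>

lemma E_conseq: "\<lbrakk>\<phi> \<in> E_logic; \<And>w. ptrue w \<phi> \<Longrightarrow> ptrue w \<psi>\<rbrakk> \<Longrightarrow> \<psi> \<in> E_logic"
  by (rule E_logic.mp, assumption, rule E_logic.taut) (auto simp: tautology_def)

lemma E_And: "\<lbrakk>\<phi> \<in> E_logic; \<psi> \<in> E_logic\<rbrakk> \<Longrightarrow> And \<phi> \<psi> \<in> E_logic"
  by (rule E_logic.mp[of \<psi>], assumption, rule E_conseq[of \<phi>]) auto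

lemma E_conseq2:
  "\<lbrakk>\<phi> \<in> E_logic; \<psi> \<in> E_logic; \<And>w. \<lbrakk>ptrue w \<phi>; ptrue w \<psi>\<rbrakk> \<Longrightarrow> ptrue w \<chi>\<rbrakk> \<Longrightarrow> \<chi> \<in> E_logic"
  by (rule E_conseq[OF E_And[of \<phi> \<psi>]]) auto

lemma fm_equiv_refl [simp]: "\<phi> \<approx>\<^sub>E \<phi>"
  unfolding fm_equiv_def by (rule E_logic.taut) (auto simp: tautology_def)

lemma fm_equiv_sym: "\<phi> \<approx>\<^sub>E \<psi> \<Longrightarrow> \<psi> \<approx>\<^sub>E \<phi>"
  unfolding fm_equiv_def by (rule E_conseq[of "Iff \<phi> \<psi>"]) auto

lemma fm_equiv_trans: "\<lbrakk>\<phi> \<approx>\<^sub>E \<psi>; \<psi> \<approx>\<^sub>E \<chi>\<rbrakk> \<Longrightarrow> \<phi> \<approx>\<^sub>E \<chi>"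
  unfolding fm_equiv_def by (rule E_conseq2[of "Iff \<phi> \<psi>" "Iff \<psi> \<chi>"], assumption, assumption, unfold ptrue.simps) blast

lemma fm_equiv_Neg: "\<phi> \<approx>\<^sub>E \<phi>' \<Longrightarrow> Neg \<phi> \<approx>\<^sub>E Neg \<phi>'"
  unfolding fm_equiv_def by (rule E_conseq[of "Iff \<phi> \<phi>'"]) auto

lemma fm_equiv_Or: "\<lbrakk>\<phi> \<approx>\<^sub>E \<phi>'; \<psi> \<approx>\<^sub>E \<psi>'\<rbrakk> \<Longrightarrow> Or \<phi> \<psi> \<approx>\<^sub>E Or \<phi>' \<psi>'"
  unfolding fm_equiv_def by (rule E_conseq2[of "Iff \<phi> \<phi>'" "Iff \<psi> \<psi>'"]) auto

lemma fm_equiv_And: "\<lbrakk>\<phi> \<approx>\<^sub>E \<phi>'; \<psi> \<approx>\<^sub>E \<psi>'\<rbrakk> \<Longrightarrow> And \<phi> \<psi> \<approx>\<^sub>E And \<phi>' \<psi>'"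
  unfolding fm_equiv_def by (rule E_conseq2[of "Iff \<phi> \<phi>'" "Iff \<psi> \<psi>'"]) auto

lemma fm_equiv_Dia: "\<phi> \<approx>\<^sub>E \<phi>' \<Longrightarrow> Dia \<phi> \<approx>\<^sub>E Dia \<phi>'"
  unfolding fm_equiv_def by (rule E_logic.re)

lemma fm_equiv_subst: "\<phi> \<approx>\<^sub>E \<psi> \<Longrightarrow> subst s \<phi> \<approx>\<^sub>E subst s \<psi>"
  unfolding fm_equiv_def using E_logic.us[of "Iff \<phi> \<psi>" s] by simp

lemma subst_fm_equiv: "(\<And>i. i \<in> vars \<phi> \<Longrightarrow> s i \<approx>\<^sub>E t i) \<Longrightarrow> subst s \<phi> \<approx>\<^sub>E subst t \<phi>"
  by (induction \<phi>) (auto intro: fm_equiv_Neg fm_equiv_Or fm_equiv_And fm_equiv_Dia)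

lemma subst_cong_vars: "(\<And>i. i \<in> vars \<phi> \<Longrightarrow> s i = t i) \<Longrightarrow> subst s \<phi> = subst t \<phi>"
  by (induction \<phi>) auto

lemma subst_subst: "subst t (subst s \<phi>) = subst (\<lambda>i. subst t (s i)) \<phi>"
  by (induction \<phi>) auto

lemma subst_Var [simp]: "subst Var \<phi> = \<phi>"
  by (induction \<phi>) auto

lemma vars_subst: "vars (subst s \<phi>) = (\<Union>i\<in>vars \<phi>. vars (s i))"
  by (induction \<phi>) auto

lemma depth_subst: "(\<And>i. i \<in> vars \<phi> \<Longrightarrow> depth (s i) = 0) \<Longrightarrow> depth (subst s \<phi>) = depth \<phi>"
  by (induction \<phi>) auto

lemma tup_subst_Fms:
  assumes "\<sigma> \<in> subst_tuples v" "\<phi> \<in> Fms v d"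
  shows "\<phi> \<circ>\<^sub>s \<sigma> \<in> Fms v d"
proof -
  have *: "\<sigma> ! i \<in> Fms v 0" if "i < v" for i
    using assms(1) that by (force simp: subst_tuples_def)
  have v: "length \<sigma> = v" "vars \<phi> \<subseteq> {..<v}"
    using assms by (auto simp: subst_tuples_def Fms_def)
  have "depth (\<phi> \<circ>\<^sub>s \<sigma>) = depth \<phi>"
    unfolding tup_subst_def using * v by (intro depth_subst) (auto simp: Fms_def)
  moreover have "vars (\<phi> \<circ>\<^sub>s \<sigma>) \<subseteq> {..<v}"
    unfolding tup_subst_def vars_subst using * v by (auto simp: Fms_def subset_iff)
  ultimately show ?thesis
    using assms(2) by (simp add: Fms_def)
qed

lemma tup_subst_cong:
  assumes "\<phi> \<approx>\<^sub>E \<psi>" "list_all2 (\<approx>\<^sub>E) \<sigma> \<tau>"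
  shows "\<phi> \<circ>\<^sub>s \<sigma> \<approx>\<^sub>E \<psi> \<circ>\<^sub>s \<tau>"
proof -
  have "\<phi> \<circ>\<^sub>s \<sigma> \<approx>\<^sub>E \<psi> \<circ>\<^sub>s \<sigma>"
    unfolding tup_subst_def by (rule fm_equiv_subst[OF assms(1)])
  moreover have "\<psi> \<circ>\<^sub>s \<sigma> \<approx>\<^sub>E \<psi> \<circ>\<^sub>s \<tau>"
    unfolding tup_subst_def using assms(2)
    by (intro subst_fm_equiv) (auto simp: list_all2_conv_all_nth)
  ultimately show ?thesis by (rule fm_equiv_trans)
qed

lemma tup_subst_assoc:
  assumes "vars \<phi> \<subseteq> {..<length \<sigma>}"
  shows "\<phi> \<circ>\<^sub>s \<sigma> \<circ>\<^sub>s \<tau> = \<phi> \<circ>\<^sub>s map (\<lambda>\<psi>. \<psi> \<circ>\<^sub>s \<tau>) \<sigma>"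
  unfolding tup_subst_def subst_subst using assms by (intro subst_cong_vars) auto

lemma tup_subst_id: "\<phi> \<circ>\<^sub>s map Var [0..<v] = \<phi>"
proof -
  have "(\<lambda>i. if i < length (map Var [0..<v]) then map Var [0..<v] ! i else Var i) = Var"
    by auto
  then show ?thesis by (simp only: tup_subst_def subst_Var)
qed

lemma equiv_Fms_rel: "equiv (Fms v d) (Fms_rel v d)"
  by (rule equivI)
    (auto simp: Fms_rel_def refl_on_def sym_def trans_def intro: fm_equiv_sym fm_equiv_trans)

lemma equiv_subst_rel: "equiv (subst_tuples v) (subst_rel v)"
proof (rule equivI)
  show "trans (subst_rel v)"
    by (auto simp: subst_rel_def trans_def intro: list_all2_trans[OF fm_equiv_trans])
qed (auto simp: subst_rel_def refl_on_def sym_def list_all2_conv_all_nth intro: fm_equiv_sym)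

lemma subst_comp_tuples:
  "\<lbrakk>\<sigma> \<in> subst_tuples v; \<tau> \<in> subst_tuples v\<rbrakk> \<Longrightarrow> map (\<lambda>\<phi>. \<phi> \<circ>\<^sub>s \<tau>) \<sigma> \<in> subst_tuples v"
  unfolding subst_tuples_def mem_Collect_eq set_map length_map
  by (blast intro: tup_subst_Fms[unfolded subst_tuples_def])

lemma subst_id_tuples: "map Var [0..<v] \<in> subst_tuples v"
  by (auto simp: subst_tuples_def Fms_def)

lemma subst_mult_class:
  assumes "\<sigma> \<in> subst_tuples v" "\<tau> \<in> subst_tuples v"
  shows "(subst_rel v `` {\<sigma>}) \<otimes>\<^bsub>subst_monoid v\<^esub> (subst_rel v `` {\<tau>}) =
    subst_rel v `` {map (\<lambda>\<phi>. \<phi> \<circ>\<^sub>s \<tau>) \<sigma>}"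
proof -
  have "subst_rel v `` {map (\<lambda>\<phi>. \<phi> \<circ>\<^sub>s \<tau>') \<sigma>'} = subst_rel v `` {map (\<lambda>\<phi>. \<phi> \<circ>\<^sub>s \<tau>) \<sigma>}"
    if "\<sigma>' \<in> subst_rel v `` {\<sigma>}" "\<tau>' \<in> subst_rel v `` {\<tau>}" for \<sigma>' \<tau>'
  proof (rule equiv_class_eq[OF equiv_subst_rel, symmetric])
    show "(map (\<lambda>\<phi>. \<phi> \<circ>\<^sub>s \<tau>) \<sigma>, map (\<lambda>\<phi>. \<phi> \<circ>\<^sub>s \<tau>') \<sigma>') \<in> subst_rel v"
      using that subst_comp_tuples tup_subst_cong
      by (auto simp: subst_rel_def list_all2_conv_all_nth)
  qed
  moreover have "\<sigma> \<in> subst_rel v `` {\<sigma>}" "\<tau> \<in> subst_rel v `` {\<tau>}"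
    using assms equiv_class_self[OF equiv_subst_rel] by auto
  ultimately show ?thesis unfolding subst_monoid_def monoid.simps by blast
qed

lemma subst_carrierE:
  assumes "A \<in> carrier (subst_monoid v)"
  obtains \<sigma> where "\<sigma> \<in> subst_tuples v" "A = subst_rel v `` {\<sigma>}"
  using assms by (auto simp: subst_monoid_def elim: quotientE)

lemma subst_carrierI: "\<sigma> \<in> subst_tuples v \<Longrightarrow> subst_rel v `` {\<sigma>} \<in> carrier (subst_monoid v)"
  by (auto simp: subst_monoid_def intro: quotientI)

theorem monoid_subst_monoid: "monoid (subst_monoid v)"
proof
  fix A B assume "A \<in> carrier (subst_monoid v)" "B \<in> carrier (subst_monoid v)"
  then show "A \<otimes>\<^bsub>subst_monoid v\<^esub> B \<in> carrier (subst_monoid v)"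
    by (elim subst_carrierE) (simp add: subst_carrierI subst_comp_tuples subst_mult_class)
next
  fix A B C
  assume "A \<in> carrier (subst_monoid v)" "B \<in> carrier (subst_monoid v)" "C \<in> carrier (subst_monoid v)"
  then obtain \<sigma> \<tau> \<rho> where *: "\<sigma> \<in> subst_tuples v" "\<tau> \<in> subst_tuples v" "\<rho> \<in> subst_tuples v"
    "A = subst_rel v `` {\<sigma>}" "B = subst_rel v `` {\<tau>}" "C = subst_rel v `` {\<rho>}"
    by (elim subst_carrierE) blast
  have "map (\<lambda>\<phi>. \<phi> \<circ>\<^sub>s \<rho>) (map (\<lambda>\<phi>. \<phi> \<circ>\<^sub>s \<tau>) \<sigma>) = map (\<lambda>\<phi>. \<phi> \<circ>\<^sub>s map (\<lambda>\<phi>. \<phi> \<circ>\<^sub>s \<rho>) \<tau>) \<sigma>"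
    using * by (simp add: subst_tuples_def Fms_def subset_iff) (auto intro!: tup_subst_assoc)
  then show "A \<otimes>\<^bsub>subst_monoid v\<^esub> B \<otimes>\<^bsub>subst_monoid v\<^esub> C = A \<otimes>\<^bsub>subst_monoid v\<^esub> (B \<otimes>\<^bsub>subst_monoid v\<^esub> C)"
    using * by (simp add: subst_mult_class subst_comp_tuples del: map_map)
next
  show "\<one>\<^bsub>subst_monoid v\<^esub> \<in> carrier (subst_monoid v)"
    using subst_carrierI[OF subst_id_tuples] by (simp add: subst_monoid_def)
next
  have one: "\<one>\<^bsub>subst_monoid v\<^esub> = subst_rel v `` {map Var [0..<v]}"
    by (simp add: subst_monoid_def)
  fix A assume "A \<in> carrier (subst_monoid v)"
  then obtain \<sigma> where *: "\<sigma> \<in> subst_tuples v" "A = subst_rel v `` {\<sigma>}"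
    by (rule subst_carrierE)
  have "map (\<lambda>\<phi>. \<phi> \<circ>\<^sub>s \<sigma>) (map Var [0..<v]) = \<sigma>"
    using * by (auto simp: subst_tuples_def tup_subst_def intro!: nth_equalityI)
  then show "\<one>\<^bsub>subst_monoid v\<^esub> \<otimes>\<^bsub>subst_monoid v\<^esub> A = A"
    using * by (simp add: one subst_mult_class subst_id_tuples del: map_map)
  show "A \<otimes>\<^bsub>subst_monoid v\<^esub> \<one>\<^bsub>subst_monoid v\<^esub> = A"
    using * by (simp add: one subst_mult_class subst_id_tuples tup_subst_id)
qed

theorem group_prime_subst_group: "group (prime_subst_group v)"
  unfolding prime_subst_group_def by (rule monoid.units_group[OF monoid_subst_monoid])

lemma Fms_Or: "\<lbrakk>\<phi> \<in> Fms v d; \<psi> \<in> Fms v d\<rbrakk> \<Longrightarrow> Or \<phi> \<psi> \<in> Fms v d"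
  and Fms_And: "\<lbrakk>\<phi> \<in> Fms v d; \<psi> \<in> Fms v d\<rbrakk> \<Longrightarrow> And \<phi> \<psi> \<in> Fms v d"
  by (auto simp: Fms_def)

lemma E_carrierE:
  assumes "A \<in> carrier (E_lattice v d)"
  obtains \<phi> where "\<phi> \<in> Fms v d" "A = fm_class v d \<phi>"
  using assms by (auto simp: E_lattice_def fm_class_def elim: quotientE)

lemma E_carrierI [simp]: "\<phi> \<in> Fms v d \<Longrightarrow> fm_class v d \<phi> \<in> carrier (E_lattice v d)"
  by (auto simp: E_lattice_def fm_class_def intro: quotientI)

lemma fm_class_eq_iff:
  "\<lbrakk>\<phi> \<in> Fms v d; \<psi> \<in> Fms v d\<rbrakk> \<Longrightarrow> fm_class v d \<phi> = fm_class v d \<psi> \<longleftrightarrow> \<phi> \<approx>\<^sub>E \<psi>"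
  unfolding fm_class_def by (subst eq_equiv_class_iff[OF equiv_Fms_rel]) (auto simp: Fms_rel_def)

lemma E_le_iff:
  assumes "\<phi> \<in> Fms v d" "\<psi> \<in> Fms v d"
  shows "fm_class v d \<phi> \<sqsubseteq>\<^bsub>E_lattice v d\<^esub> fm_class v d \<psi> \<longleftrightarrow> Imp \<phi> \<psi> \<in> E_logic"
proof
  assume "fm_class v d \<phi> \<sqsubseteq>\<^bsub>E_lattice v d\<^esub> fm_class v d \<psi>"
  then obtain \<phi>' \<psi>' where *: "Iff \<phi> \<phi>' \<in> E_logic" "Iff \<psi> \<psi>' \<in> E_logic" "Imp \<phi>' \<psi>' \<in> E_logic"
    by (auto simp: E_lattice_def fm_class_def Fms_rel_def fm_equiv_def)
  show "Imp \<phi> \<psi> \<in> E_logic"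
    by (rule E_conseq2[OF E_And[OF *(1,2)] *(3)]) auto
next
  assume "Imp \<phi> \<psi> \<in> E_logic"
  then show "fm_class v d \<phi> \<sqsubseteq>\<^bsub>E_lattice v d\<^esub> fm_class v d \<psi>"
    using assms by (simp add: E_lattice_def fm_class_def Fms_rel_def Bex_def) (metis fm_equiv_refl)
qed

lemma partial_order_E_lattice: "partial_order (E_lattice v d)"
proof
  show "(.=\<^bsub>E_lattice v d\<^esub>) = (=)"
    by (simp add: E_lattice_def)
next
  fix A assume "A \<in> carrier (E_lattice v d)"
  then obtain \<phi> where "\<phi> \<in> Fms v d" "A = fm_class v d \<phi>" by (rule E_carrierE)
  then show "A \<sqsubseteq>\<^bsub>E_lattice v d\<^esub> A"
    by (auto simp: E_le_iff tautology_def intro: E_logic.taut)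
next
  fix A B
  assume le: "A \<sqsubseteq>\<^bsub>E_lattice v d\<^esub> B" "B \<sqsubseteq>\<^bsub>E_lattice v d\<^esub> A"
    and "A \<in> carrier (E_lattice v d)" "B \<in> carrier (E_lattice v d)"
  then obtain \<phi> \<psi> where *: "\<phi> \<in> Fms v d" "A = fm_class v d \<phi>" "\<psi> \<in> Fms v d" "B = fm_class v d \<psi>"
    by (elim E_carrierE) blast
  then have "\<phi> \<approx>\<^sub>E \<psi>"
    using le by (auto simp: E_le_iff fm_equiv_def intro: E_And)
  then show "A .=\<^bsub>E_lattice v d\<^esub> B"
    using * by (simp add: E_lattice_def fm_class_eq_iff)
next
  fix A B C
  assume le: "A \<sqsubseteq>\<^bsub>E_lattice v d\<^esub> B" "B \<sqsubseteq>\<^bsub>E_lattice v d\<^esub> C"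
    and "A \<in> carrier (E_lattice v d)" "B \<in> carrier (E_lattice v d)" "C \<in> carrier (E_lattice v d)"
  then obtain \<phi> \<psi> \<chi> where *: "\<phi> \<in> Fms v d" "A = fm_class v d \<phi>" "\<psi> \<in> Fms v d"
    "B = fm_class v d \<psi>" "\<chi> \<in> Fms v d" "C = fm_class v d \<chi>"
    by (elim E_carrierE) blast
  then have "Imp \<phi> \<psi> \<in> E_logic" "Imp \<psi> \<chi> \<in> E_logic"
    using le by (auto simp: E_le_iff)
  then have "Imp \<phi> \<chi> \<in> E_logic"
    by (rule E_conseq2) auto
  then show "A \<sqsubseteq>\<^bsub>E_lattice v d\<^esub> C"
    using * by (simp add: E_le_iff)
qed (auto simp: E_lattice_def)

lemma E_least:
  assumes "\<phi> \<in> Fms v d" "\<psi> \<in> Fms v d"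
  shows "least (E_lattice v d) (fm_class v d (Or \<phi> \<psi>))
    (Upper (E_lattice v d) {fm_class v d \<phi>, fm_class v d \<psi>})"
proof (rule least_UpperI)
  fix A assume "A \<in> {fm_class v d \<phi>, fm_class v d \<psi>}"
  then show "A \<sqsubseteq>\<^bsub>E_lattice v d\<^esub> fm_class v d (Or \<phi> \<psi>)"
    using assms by (auto simp: E_le_iff Fms_Or tautology_def intro!: E_logic.taut)
next
  fix A assume A: "A \<in> Upper (E_lattice v d) {fm_class v d \<phi>, fm_class v d \<psi>}"
  then obtain \<chi> where \<chi>: "\<chi> \<in> Fms v d" "A = fm_class v d \<chi>"
    by (auto simp: Upper_def elim: E_carrierE)
  then have "Imp \<phi> \<chi> \<in> E_logic" "Imp \<psi> \<chi> \<in> E_logic"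
    using A assms by (auto simp: Upper_def E_le_iff)
  then have "Imp (Or \<phi> \<psi>) \<chi> \<in> E_logic"
    by (rule E_conseq2) auto
  then show "fm_class v d (Or \<phi> \<psi>) \<sqsubseteq>\<^bsub>E_lattice v d\<^esub> A"
    using \<chi> assms by (simp add: E_le_iff Fms_Or)
qed (use assms in \<open>auto simp: Fms_Or\<close>)

lemma E_greatest:
  assumes "\<phi> \<in> Fms v d" "\<psi> \<in> Fms v d"
  shows "greatest (E_lattice v d) (fm_class v d (And \<phi> \<psi>))
    (Lower (E_lattice v d) {fm_class v d \<phi>, fm_class v d \<psi>})"
proof (rule greatest_LowerI)
  fix A assume "A \<in> {fm_class v d \<phi>, fm_class v d \<psi>}"
  then show "fm_class v d (And \<phi> \<psi>) \<sqsubseteq>\<^bsub>E_lattice v d\<^esub> A"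
    using assms by (auto simp: E_le_iff Fms_And tautology_def intro!: E_logic.taut)
next
  fix A assume A: "A \<in> Lower (E_lattice v d) {fm_class v d \<phi>, fm_class v d \<psi>}"
  then obtain \<chi> where \<chi>: "\<chi> \<in> Fms v d" "A = fm_class v d \<chi>"
    by (auto simp: Lower_def elim: E_carrierE)
  then have "Imp \<chi> \<phi> \<in> E_logic" "Imp \<chi> \<psi> \<in> E_logic"
    using A assms by (auto simp: Lower_def E_le_iff)
  then have "Imp \<chi> (And \<phi> \<psi>) \<in> E_logic"
    by (rule E_conseq2) auto
  then show "A \<sqsubseteq>\<^bsub>E_lattice v d\<^esub> fm_class v d (And \<phi> \<psi>)"
    using \<chi> assms by (simp add: E_le_iff Fms_And)
qed (use assms in \<open>auto simp: Fms_And\<close>)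

theorem lattice_E_lattice: "lattice (E_lattice v d)"
proof -
  interpret partial_order "E_lattice v d" by (rule partial_order_E_lattice)
  show ?thesis
    by unfold_locales ((elim E_carrierE, blast intro: E_least), (elim E_carrierE, blast intro: E_greatest))
qed

theorem join_E_lattice:
  assumes "\<phi> \<in> Fms v d" "\<psi> \<in> Fms v d"
  shows "fm_class v d \<phi> \<squnion>\<^bsub>E_lattice v d\<^esub> fm_class v d \<psi> = fm_class v d (Or \<phi> \<psi>)"
proof -
  interpret lattice "E_lattice v d" by (rule lattice_E_lattice)
  show ?thesis
    unfolding join_def using assms
    by (intro least_unique[OF sup_of_two_least E_least]) auto
qed

theorem meet_E_lattice:
  assumes "\<phi> \<in> Fms v d" "\<psi> \<in> Fms v d"
  shows "fm_class v d \<phi> \<sqinter>\<^bsub>E_lattice v d\<^esub> fm_class v d \<psi> = fm_class v d (And \<phi> \<psi>)"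
proof -
  interpret lattice "E_lattice v d" by (rule lattice_E_lattice)
  show ?thesis
    unfolding meet_def using assms
    by (intro greatest_unique[OF inf_of_two_greatest E_greatest]) auto
qed

end

theory Submission
  imports Defs
begin

text \<open>The level-\<open>d\<close> minterms are the atoms of \<open>E[v,d]\<close>: they are exhaustive, pairwise exclusive,
  consistent, and each of them decides every formula of \<open>Fms v d\<close>. Consistency rests on the fact that
  every theorem of \<open>E\<close> is true under each valuation of variables and diamonds that does not separate
  \<open>Dia \<phi>\<close> from \<open>Dia \<psi>\<close> when \<open>\<phi> \<approx>\<^sub>E \<psi>\<close>; as distinct DCF formulas are inequivalent, the signs of their
  diamonds can be prescribed freely. A prime substitution has an inverse up to equivalence, so it
  permutes equivalence classes, preserves consistency and implication, and hence permutes the atoms.\<close>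

section \<open>Derivability in \<open>E\<close>\<close>

text \<open>Modus ponens handles one premise at a time, so the premises are first folded into a
  single conjunction. The rule serves arguments with one premise per minterm.\<close>

lemma E_conseq_finite:
  assumes "finite A" "A \<subseteq> E_logic" "\<And>w. (\<And>\<phi>. \<phi> \<in> A \<Longrightarrow> ptrue w \<phi>) \<Longrightarrow> ptrue w \<psi>"
  shows "\<psi> \<in> E_logic"
proof -
  have "\<exists>\<chi>\<in>E_logic. \<forall>w. ptrue w \<chi> \<longleftrightarrow> (\<forall>\<phi>\<in>A. ptrue w \<phi>)"
    using assms(1,2)
  proof (induction A rule: finite_induct)
    case empty
    have "Top \<in> E_logic" by (rule E_logic.taut) (simp add: tautology_def)
    then show ?case by (intro bexI[of _ Top]) auto
  next
    case (insert \<phi> A)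
    then obtain \<chi> where "\<chi> \<in> E_logic" "\<forall>w. ptrue w \<chi> \<longleftrightarrow> (\<forall>\<phi>\<in>A. ptrue w \<phi>)" by auto
    with insert.prems show ?case by (intro bexI[of _ "And \<phi> \<chi>"]) (auto intro: E_And)
  qed
  then obtain \<chi> where \<chi>: "\<chi> \<in> E_logic" "\<And>w. ptrue w \<chi> \<longleftrightarrow> (\<forall>\<phi>\<in>A. ptrue w \<phi>)" by blast
  show ?thesis by (rule E_conseq[OF \<chi>(1)]) (simp add: \<chi>(2) assms(3))
qed

lemma fm_equiv_iff_Imp: "\<phi> \<approx>\<^sub>E \<psi> \<longleftrightarrow> Imp \<phi> \<psi> \<in> E_logic \<and> Imp \<psi> \<phi> \<in> E_logic"
proof
  assume "\<phi> \<approx>\<^sub>E \<psi>"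
  then have *: "Iff \<phi> \<psi> \<in> E_logic" by (simp add: fm_equiv_def)
  show "Imp \<phi> \<psi> \<in> E_logic \<and> Imp \<psi> \<phi> \<in> E_logic"
    by (intro conjI; rule E_conseq[OF *]) auto
qed (auto simp: fm_equiv_def intro: E_And)

section \<open>Valuations under which all theorems of E are true\<close>

definition respects_equiv :: "(fm \<Rightarrow> bool) \<Rightarrow> bool" where
  "respects_equiv w \<longleftrightarrow> (\<forall>\<phi> \<psi>. \<phi> \<approx>\<^sub>E \<psi> \<longrightarrow> w (Dia \<phi>) = w (Dia \<psi>))"

text \<open>Evaluating after a substitution amounts to changing the valuation: each atom receives
  the truth value of its substitution instance.\<close>

lemma ptrue_subst: "ptrue w (subst s \<phi>) \<longleftrightarrow> ptrue (\<lambda>\<psi>. ptrue w (subst s \<psi>)) \<phi>"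
  by (induction \<phi>) auto

text \<open>The induction generalises over \<open>w\<close> because uniform substitution changes the
  valuation. The changed one still respects equivalence, as equivalence is closed under
  substitution; the case of RE is the defining condition on \<open>w\<close>.\<close>

lemma ptrue_E_logic:
  assumes "\<phi> \<in> E_logic" "respects_equiv w"
  shows "ptrue w \<phi>"
  using assms
proof (induction arbitrary: w rule: E_logic.induct)
  case (us \<phi> s)
  have "respects_equiv (\<lambda>\<psi>. ptrue w (subst s \<psi>))"
    using us.prems by (auto simp: respects_equiv_def intro: fm_equiv_subst)
  then show ?case unfolding ptrue_subst[of w s \<phi>] by (rule us.IH)
next
  case (re \<phi> \<psi>)
  then show ?case by (auto simp: respects_equiv_def fm_equiv_def)
qed (auto simp: tautology_def)

section \<open>Minterms as atoms\<close>

lemma ptrue_conj_list [simp]: "ptrue w (conj_list \<phi>s) \<longleftrightarrow> (\<forall>\<phi>\<in>set \<phi>s. ptrue w \<phi>)"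
  by (induction \<phi>s rule: conj_list.induct) auto

lemma ptrue_disj_list [simp]: "ptrue w (disj_list \<phi>s) \<longleftrightarrow> (\<exists>\<phi>\<in>set \<phi>s. ptrue w \<phi>)"
  by (induction \<phi>s rule: disj_list.induct) auto

lemma conj_list_Fms: "set \<phi>s \<subseteq> Fms v d \<Longrightarrow> conj_list \<phi>s \<in> Fms v d"
  by (induction \<phi>s rule: conj_list.induct) (auto simp: Fms_def)

lemma disj_list_Fms: "set \<phi>s \<subseteq> Fms v d \<Longrightarrow> disj_list \<phi>s \<in> Fms v d"
  by (induction \<phi>s rule: disj_list.induct) (auto simp: Fms_def)

text \<open>Equal lengths rule out confusing a conjunction that is an entry with one built by the
  list: \<open>[And \<phi> \<psi>]\<close> and \<open>[\<phi>, \<psi>]\<close> give the same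
  formula.\<close>

lemma conj_list_inject:
  "length \<phi>s = length \<psi>s \<Longrightarrow> conj_list \<phi>s = conj_list \<psi>s \<Longrightarrow> \<phi>s = \<psi>s"
proof (induction \<phi>s arbitrary: \<psi>s rule: conj_list.induct)
  case 1
  then show ?case by simp
next
  case (2 \<phi>)
  then show ?case by (cases \<psi>s rule: conj_list.cases) simp_all
next
  case (3 \<phi> \<psi> \<chi>s)
  then obtain \<phi>' \<psi>' \<chi>s' where \<psi>s: "\<psi>s = \<phi>' # \<psi>' # \<chi>s'"
    by (cases \<psi>s rule: conj_list.cases) simp_all
  with "3.prems" have "\<psi> # \<chi>s = \<psi>' # \<chi>s'" by (intro "3.IH") simp_all
  with "3.prems" \<psi>s show ?case by simp
qed

text \<open>Signs are given by a function on formulas rather than by a list of signs, so that a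
  valuation can itself serve as a choice of signs.\<close>

definition signed_conj :: "(fm \<Rightarrow> bool) \<Rightarrow> fm list \<Rightarrow> fm" where
  "signed_conj w \<phi>s = conj_list (map (\<lambda>\<phi>. if w \<phi> then \<phi> else Neg \<phi>) \<phi>s)"

lemma ptrue_signed_conj: "ptrue w' (signed_conj w \<phi>s) \<longleftrightarrow> (\<forall>\<phi>\<in>set \<phi>s. ptrue w' \<phi> = w \<phi>)"
proof -
  have "ptrue w' (if w \<phi> then \<phi> else Neg \<phi>) \<longleftrightarrow> ptrue w' \<phi> = w \<phi>" for \<phi> by simp
  then show ?thesis unfolding signed_conj_def ptrue_conj_list set_map ball_simps by (rule ball_cong[OF refl])
qed

lemma signs_in_product_lists:
  "map (\<lambda>\<phi>. if w \<phi> then \<phi> else Neg \<phi>) \<phi>s \<in> set (product_lists (map (\<lambda>\<phi>. [\<phi>, Neg \<phi>]) \<phi>s))"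
  by (simp add: product_lists_set list_all2_map1 list_all2_map2 list_all2_same)

text \<open>Distinctness lets a function of formulas describe signs chosen position by position; a
  repeated formula could carry both signs.\<close>

lemma in_product_lists_signs:
  assumes "distinct \<phi>s" "\<psi>s \<in> set (product_lists (map (\<lambda>\<phi>. [\<phi>, Neg \<phi>]) \<phi>s))"
  shows "\<exists>w. \<psi>s = map (\<lambda>\<phi>. if w \<phi> then \<phi> else Neg \<phi>) \<phi>s"
  using assms
proof (induction \<phi>s arbitrary: \<psi>s)
  case (Cons \<phi> \<phi>s)
  from Cons.prems(2) obtain \<psi> \<chi>s where \<psi>s: "\<psi>s = \<psi> # \<chi>s" "\<psi> = \<phi> \<or> \<psi> = Neg \<phi>"
    and \<chi>s: "\<chi>s \<in> set (product_lists (map (\<lambda>\<phi>. [\<phi>, Neg \<phi>]) \<phi>s))"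
    by auto
  from Cons.IH[OF _ \<chi>s] Cons.prems(1)
  obtain w where w: "\<chi>s = map (\<lambda>\<phi>. if w \<phi> then \<phi> else Neg \<phi>) \<phi>s" by force
  \<comment> \<open>The update at \<open>\<phi>\<close> leaves the tail unchanged, since
    \<open>\<phi>\<close> does not occur there.\<close>
  define w' where "w' = w(\<phi> := (\<psi> = \<phi>))"
  have "\<chi>s = map (\<lambda>\<phi>. if w' \<phi> then \<phi> else Neg \<phi>) \<phi>s"
    unfolding w using Cons.prems(1) by (intro map_cong) (auto simp: w'_def)
  moreover have "\<psi> = (if w' \<phi> then \<phi> else Neg \<phi>)"
    using \<psi>s(2) by (auto simp: w'_def)
  ultimately show ?case
    unfolding \<psi>s(1) list.map by blast
qed simp

lemma set_signed_conjs: "distinct \<phi>s \<Longrightarrow> set (signed_conjs \<phi>s) = range (\<lambda>w. signed_conj w \<phi>s)"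
  unfolding signed_conjs_def signed_conj_def set_map
  using in_product_lists_signs[of \<phi>s] signs_in_product_lists[of _ \<phi>s] by blast

text \<open>The two choices \<open>\<phi>\<close> and \<open>Neg \<phi>\<close> always differ, so
  the product has no repetitions, and \<open>conj_list\<close> is injective on its members, which
  all have the same length.\<close>

lemma distinct_signed_conjs: "distinct (signed_conjs \<phi>s)"
proof -
  have neq: "\<phi> \<noteq> Neg \<phi>" for \<phi> by (induction \<phi>) auto
  have "distinct (product_lists (map (\<lambda>\<phi>. [\<phi>, Neg \<phi>]) \<phi>s))"
    using neq by (intro distinct_product_lists) auto
  then show ?thesis
    unfolding signed_conjs_def
    by (simp add: distinct_map inj_on_def) (metis conj_list_inject in_set_product_lists_length)
qed

section \<open>Distinctness, consistency and exclusivity of minterms\<close>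

primrec mod_atoms :: "nat \<Rightarrow> nat \<Rightarrow> fm list" where
  "mod_atoms v 0 = map Var [0..<v]"
| "mod_atoms v (Suc d) =
    map Var [0..<v] @ map Dia (map disj_list (subseqs (minterm_list v d)))"

text \<open>A single description for all levels: a minterm fixes a sign for each entry of
  \<open>mod_atoms v d\<close>.\<close>

lemma minterm_list_eq: "minterm_list v d = signed_conjs (mod_atoms v d)"
  by (cases d) auto

lemma ptrue_mod_atoms: "\<phi> \<in> set (mod_atoms v d) \<Longrightarrow> ptrue w \<phi> = w \<phi>"
  by (cases d) auto

text \<open>The prescribed signs extend from the list to a valuation that respects equivalence. It
  makes the signed conjunction true, so the negation cannot be a theorem.\<close>

lemma signed_conj_consistent:
  assumes "set \<phi>s \<subseteq> range Var \<union> range Dia"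
    and "\<And>\<phi> \<psi>. \<lbrakk>Dia \<phi> \<in> set \<phi>s; Dia \<psi> \<in> set \<phi>s; \<phi> \<approx>\<^sub>E \<psi>\<rbrakk> \<Longrightarrow> w (Dia \<phi>) = w (Dia \<psi>)"
  shows "Neg (signed_conj w \<phi>s) \<notin> E_logic"
proof
  \<comment> \<open>A diamond is true when its argument is equivalent to that of a listed diamond
    true under \<open>w\<close>; a diamond with no listed equivalent is false by default.\<close>
  define w' where "w' \<chi> = (case \<chi> of
      Dia \<phi> \<Rightarrow> \<exists>\<psi>. Dia \<psi> \<in> set \<phi>s \<and> \<phi> \<approx>\<^sub>E \<psi> \<and> w (Dia \<psi>)
    | _ \<Rightarrow> w \<chi>)" for \<chi>
  assume "Neg (signed_conj w \<phi>s) \<in> E_logic"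
  moreover have "respects_equiv w'"
    unfolding respects_equiv_def w'_def fm.case by (metis fm_equiv_sym fm_equiv_trans)
  ultimately have "ptrue w' (Neg (signed_conj w \<phi>s))" by (rule ptrue_E_logic)
  moreover have "ptrue w' \<phi> = w \<phi>" if "\<phi> \<in> set \<phi>s" for \<phi>
  proof -
    from that assms(1) consider i where "\<phi> = Var i" | \<psi> where "\<phi> = Dia \<psi>" by blast
    then show ?thesis
    proof cases
      case 1
      then show ?thesis by (simp add: w'_def)
    next
      case 2
      then have "ptrue w' \<phi> \<longleftrightarrow> (\<exists>\<chi>. Dia \<chi> \<in> set \<phi>s \<and> \<psi> \<approx>\<^sub>E \<chi> \<and> w (Dia \<chi>))"
        by (simp add: w'_def)
      also have "\<dots> \<longleftrightarrow> w \<phi>"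
        using that assms(2) fm_equiv_refl unfolding 2 by blast
      finally show ?thesis .
    qed
  qed
  ultimately show False by (simp add: ptrue_signed_conj)
qed

lemma set_subseqs_subset: "\<psi>s \<in> set (subseqs \<phi>s) \<Longrightarrow> set \<psi>s \<subseteq> set \<phi>s"
  using subseqs_powset[of \<phi>s] by blast

text \<open>A disjunct missing on the right would imply a disjunction of formulas that all exclude
  it, and so be refutable. Consistency and exclusivity are hypotheses here because the lemma is
  applied inside the induction that establishes them.\<close>

lemma disj_list_equiv_imp_subset:
  assumes "set \<phi>s \<subseteq> M" "set \<psi>s \<subseteq> M" "disj_list \<phi>s \<approx>\<^sub>E disj_list \<psi>s"
    and consistent: "\<And>\<mu>. \<mu> \<in> M \<Longrightarrow> Neg \<mu> \<notin> E_logic"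
    and exclusive: "\<And>w \<mu> \<nu>. \<lbrakk>\<mu> \<in> M; \<nu> \<in> M; ptrue w \<mu>; ptrue w \<nu>\<rbrakk> \<Longrightarrow> \<mu> = \<nu>"
  shows "set \<phi>s \<subseteq> set \<psi>s"
proof (rule subsetI, rule ccontr)
  fix \<mu> assume \<mu>: "\<mu> \<in> set \<phi>s" "\<mu> \<notin> set \<psi>s"
  have "Imp (disj_list \<phi>s) (disj_list \<psi>s) \<in> E_logic"
    using assms(3) by (simp add: fm_equiv_iff_Imp)
  then have "Neg \<mu> \<in> E_logic"
  proof (rule E_conseq)
    fix w assume "ptrue w (Imp (disj_list \<phi>s) (disj_list \<psi>s))"
    then show "ptrue w (Neg \<mu>)"
      using \<mu> assms(1,2) exclusive[of \<mu> _ w] by (auto simp: subset_iff)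
  qed
  then show False using \<mu> assms(1) consistent by blast
qed

text \<open>A valuation that makes a minterm true determines all of its signs. Distinctness of the
  atoms is assumed until the next induction supplies it.\<close>

lemma minterm_exclusive_aux:
  assumes "distinct (mod_atoms v d)" "\<mu> \<in> minterms v d" "\<nu> \<in> minterms v d"
    "ptrue w \<mu>" "ptrue w \<nu>"
  shows "\<mu> = \<nu>"
proof -
  obtain w1 w2 where "\<mu> = signed_conj w1 (mod_atoms v d)" "\<nu> = signed_conj w2 (mod_atoms v d)"
    using assms(1-3) by (auto simp: minterms_def minterm_list_eq set_signed_conjs)
  moreover from this have "\<forall>\<phi>\<in>set (mod_atoms v d). w1 \<phi> = w2 \<phi>"
    using assms(4,5) by (simp add: ptrue_signed_conj)
  ultimately show ?thesis
    by (simp add: signed_conj_def cong: map_cong)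
qed

text \<open>The two claims support each other: at level \<open>d\<close> they make distinct DCF
  formulas inequivalent, so at level \<open>Suc d\<close> the diamonds are distinct and their signs
  can be chosen freely.\<close>

lemma distinct_mod_atoms_consistent:
  "distinct (mod_atoms v d) \<and> (\<forall>\<mu>\<in>minterms v d. Neg \<mu> \<notin> E_logic)"
proof (induction d)
  case 0
  have "distinct (mod_atoms v 0)" by (simp add: distinct_map inj_on_def)
  moreover have "Neg (signed_conj w (mod_atoms v 0)) \<notin> E_logic" for w
    by (rule signed_conj_consistent) auto
  ultimately show ?case by (auto simp: minterms_def minterm_list_eq set_signed_conjs simp del: mod_atoms.simps)
next
  case (Suc d)
  let ?D = "subseqs (minterm_list v d)"
  have inj: "\<phi>s = \<psi>s"
    if "\<phi>s \<in> set ?D" "\<psi>s \<in> set ?D" "disj_list \<phi>s \<approx>\<^sub>E disj_list \<psi>s" for \<phi>s \<psi>s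
  proof -
    have M: "set \<phi>s \<subseteq> minterms v d" "set \<psi>s \<subseteq> minterms v d"
      using that(1,2) set_subseqs_subset by (auto simp: minterms_def)
    have "set \<phi>s \<subseteq> set \<psi>s"
      using disj_list_equiv_imp_subset[OF M that(3)] Suc minterm_exclusive_aux by blast
    moreover have "set \<psi>s \<subseteq> set \<phi>s"
      using disj_list_equiv_imp_subset[OF M(2,1) fm_equiv_sym[OF that(3)]] Suc minterm_exclusive_aux
      by blast
    \<comment> \<open>The list of minterms is duplicate-free, so a subsequence is determined by its
      set of entries.\<close>
    moreover have "distinct (map set ?D)"
      by (simp add: distinct_set_subseqs minterm_list_eq distinct_signed_conjs)
    ultimately show ?thesis
      using that(1,2) by (auto simp: distinct_map inj_on_def)
  qed
  have "distinct (map set ?D)"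
    by (simp add: distinct_set_subseqs minterm_list_eq distinct_signed_conjs)
  then have "distinct ?D" by (simp only: distinct_map)
  then have "distinct (mod_atoms v (Suc d))"
    using inj by (auto simp: distinct_map inj_on_def)
  \<comment> \<open>Listed diamonds with equivalent arguments coincide by \<open>inj\<close>, so
    every choice of signs meets the condition of \<open>signed_conj_consistent\<close>.\<close>
  moreover have "Neg (signed_conj w (mod_atoms v (Suc d))) \<notin> E_logic" for w
    by (rule signed_conj_consistent) (auto dest: inj)
  ultimately show ?case
    by (auto simp: minterms_def minterm_list_eq set_signed_conjs simp del: mod_atoms.simps)
qed

lemma minterms_eq: "minterms v d = range (\<lambda>w. signed_conj w (mod_atoms v d))"
  using distinct_mod_atoms_consistent by (simp add: minterms_def minterm_list_eq set_signed_conjs)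

lemma minterm_consistent: "\<mu> \<in> minterms v d \<Longrightarrow> Neg \<mu> \<notin> E_logic"
  using distinct_mod_atoms_consistent by blast

lemma minterm_exclusive:
  "\<lbrakk>\<mu> \<in> minterms v d; \<nu> \<in> minterms v d; ptrue w \<mu>; ptrue w \<nu>\<rbrakk> \<Longrightarrow> \<mu> = \<nu>"
  using minterm_exclusive_aux distinct_mod_atoms_consistent by blast

text \<open>The minterm whose signs are read off \<open>w\<close> is true under
  \<open>w\<close>.\<close>

lemma minterm_exhaustive: "\<exists>\<mu>\<in>minterms v d. ptrue w \<mu>"
  by (auto simp: minterms_eq ptrue_signed_conj ptrue_mod_atoms)

lemma finite_minterms: "finite (minterms v d)"
  by (simp add: minterms_def)

lemma signed_conj_Fms:
  assumes "set \<phi>s \<subseteq> Fms v d"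
  shows "signed_conj w \<phi>s \<in> Fms v d"
proof -
  have "Neg \<phi> \<in> Fms v d" if "\<phi> \<in> Fms v d" for \<phi>
    using that by (simp add: Fms_def)
  with assms show ?thesis
    unfolding signed_conj_def by (intro conj_list_Fms) auto
qed

lemma minterms_Fms: "minterms v d \<subseteq> Fms v d"
proof (induction d)
  case 0
  have "signed_conj w (mod_atoms v 0) \<in> Fms v 0" for w
    by (rule signed_conj_Fms) (auto simp: Fms_def)
  then show ?case unfolding minterms_eq by blast
next
  case (Suc d)
  have "disj_list \<phi>s \<in> Fms v d" if "\<phi>s \<in> set (subseqs (minterm_list v d))" for \<phi>s
    using Suc set_subseqs_subset[OF that] by (intro disj_list_Fms) (auto simp: minterms_def)
  then have "Dia (disj_list \<phi>s) \<in> Fms v (Suc d)" if "\<phi>s \<in> set (subseqs (minterm_list v d))" for \<phi>s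
    using that by (simp add: Fms_def)
  moreover have "Var i \<in> Fms v (Suc d)" if "i < v" for i
    using that by (simp add: Fms_def)
  ultimately have "set (mod_atoms v (Suc d)) \<subseteq> Fms v (Suc d)"
    by auto
  then have "signed_conj w (mod_atoms v (Suc d)) \<in> Fms v (Suc d)" for w
    by (rule signed_conj_Fms)
  then show ?case unfolding minterms_eq by blast
qed

section \<open>Decision of formulas by minterms, and disjunctive normal forms\<close>

lemma mod_atom_decided:
  assumes "\<mu> \<in> minterms v d" "\<phi> \<in> set (mod_atoms v d)"
  shows "Imp \<mu> \<phi> \<in> E_logic \<or> Imp \<mu> (Neg \<phi>) \<in> E_logic"
proof -
  obtain w where "\<mu> = signed_conj w (mod_atoms v d)" using assms(1) by (auto simp: minterms_eq)
  then show ?thesis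
    using assms(2) by (cases "w \<phi>") (auto simp: tautology_def ptrue_signed_conj intro!: E_logic.taut)
qed

text \<open>The disjuncts are the minterms that imply \<open>\<phi>\<close>. Decidedness is a
  hypothesis so that the normal form is available one level down during the induction for
  \<open>minterm_decides\<close>.\<close>

lemma equiv_disj_minterms:
  assumes "\<And>\<mu>. \<mu> \<in> minterms v d \<Longrightarrow> Imp \<mu> \<phi> \<in> E_logic \<or> Imp \<mu> (Neg \<phi>) \<in> E_logic"
  obtains \<phi>s where "\<phi>s \<in> set (subseqs (minterm_list v d))" "\<phi> \<approx>\<^sub>E disj_list \<phi>s"
proof -
  let ?P = "{\<mu> \<in> minterms v d. Imp \<mu> \<phi> \<in> E_logic}"
  have "?P \<in> set ` set (subseqs (minterm_list v d))"
    by (auto simp: subseqs_powset minterms_def)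
  then obtain \<phi>s where \<phi>s: "\<phi>s \<in> set (subseqs (minterm_list v d))" "set \<phi>s = ?P" by auto
  \<comment> \<open>One premise per minterm records how it decides \<open>\<phi>\<close>. Under any
    valuation exactly one minterm is true, and its premise settles both sides of the
    equivalence.\<close>
  let ?A = "(\<lambda>\<mu>. Imp \<mu> \<phi>) ` ?P \<union> (\<lambda>\<mu>. Imp \<mu> (Neg \<phi>)) ` (minterms v d - ?P)"
  have "Iff \<phi> (disj_list \<phi>s) \<in> E_logic"
  proof (rule E_conseq_finite[of ?A])
    fix w assume A: "\<And>\<psi>. \<psi> \<in> ?A \<Longrightarrow> ptrue w \<psi>"
    obtain \<mu> where \<mu>: "\<mu> \<in> minterms v d" "ptrue w \<mu>" using minterm_exhaustive by blast
    show "ptrue w (Iff \<phi> (disj_list \<phi>s))"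
    proof (cases "\<mu> \<in> ?P")
      case True
      with A[of "Imp \<mu> \<phi>"] \<mu> \<phi>s(2) show ?thesis by auto
    next
      case False
      with A[of "Imp \<mu> (Neg \<phi>)"] \<mu> have "\<not> ptrue w \<phi>" by auto
      moreover have "\<not> ptrue w \<nu>" if "\<nu> \<in> ?P" for \<nu>
        using minterm_exclusive[of \<nu> v d \<mu> w] that \<mu> False by blast
      ultimately show ?thesis using \<phi>s(2) by auto
    qed
  qed (use assms finite_minterms in auto)
  with \<phi>s(1) show thesis by (intro that) (auto simp: fm_equiv_def)
qed

text \<open>The level varies in the induction because a diamond passes to its argument one level
  down. The Boolean cases combine the decisions on the components.\<close>

lemma minterm_decides:
  assumes "\<phi> \<in> Fms v d" "\<mu> \<in> minterms v d"
  shows "Imp \<mu> \<phi> \<in> E_logic \<or> Imp \<mu> (Neg \<phi>) \<in> E_logic"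
  using assms
proof (induction \<phi> arbitrary: d \<mu>)
  case (Var i)
  then have "Var i \<in> set (mod_atoms v d)" by (cases d) (auto simp: Fms_def)
  then show ?case using mod_atom_decided Var.prems(2) by blast
next
  case Bot
  have "Imp \<mu> (Neg Bot) \<in> E_logic" by (rule E_logic.taut) (simp add: tautology_def)
  then show ?case ..
next
  case Top
  have "Imp \<mu> Top \<in> E_logic" by (rule E_logic.taut) (simp add: tautology_def)
  then show ?case ..
next
  case (Neg \<phi>)
  have "Imp \<mu> \<phi> \<in> E_logic \<or> Imp \<mu> (Neg \<phi>) \<in> E_logic"
    using Neg.prems by (intro Neg.IH) (simp_all add: Fms_def)
  moreover have "Imp \<mu> (Neg (Neg \<phi>)) \<in> E_logic" if "Imp \<mu> \<phi> \<in> E_logic"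
    by (rule E_conseq[OF that]) auto
  ultimately show ?case by blast
next
  case (Or \<phi> \<psi>)
  have "Imp \<mu> \<phi> \<in> E_logic \<or> Imp \<mu> (Neg \<phi>) \<in> E_logic"
    using Or.prems by (intro Or.IH(1)) (simp_all add: Fms_def)
  moreover have "Imp \<mu> \<psi> \<in> E_logic \<or> Imp \<mu> (Neg \<psi>) \<in> E_logic"
    using Or.prems by (intro Or.IH(2)) (simp_all add: Fms_def)
  moreover have "Imp \<mu> (Or \<phi> \<psi>) \<in> E_logic" if "Imp \<mu> \<phi> \<in> E_logic"
    by (rule E_conseq[OF that]) auto
  moreover have "Imp \<mu> (Or \<phi> \<psi>) \<in> E_logic" if "Imp \<mu> \<psi> \<in> E_logic"
    by (rule E_conseq[OF that]) auto
  moreover have "Imp \<mu> (Neg (Or \<phi> \<psi>)) \<in> E_logic"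
    if "Imp \<mu> (Neg \<phi>) \<in> E_logic" "Imp \<mu> (Neg \<psi>) \<in> E_logic"
    by (rule E_conseq2[OF that]) auto
  ultimately show ?case by blast
next
  case (And \<phi> \<psi>)
  have "Imp \<mu> \<phi> \<in> E_logic \<or> Imp \<mu> (Neg \<phi>) \<in> E_logic"
    using And.prems by (intro And.IH(1)) (simp_all add: Fms_def)
  moreover have "Imp \<mu> \<psi> \<in> E_logic \<or> Imp \<mu> (Neg \<psi>) \<in> E_logic"
    using And.prems by (intro And.IH(2)) (simp_all add: Fms_def)
  moreover have "Imp \<mu> (Neg (And \<phi> \<psi>)) \<in> E_logic" if "Imp \<mu> (Neg \<phi>) \<in> E_logic"
    by (rule E_conseq[OF that]) auto
  moreover have "Imp \<mu> (Neg (And \<phi> \<psi>)) \<in> E_logic" if "Imp \<mu> (Neg \<psi>) \<in> E_logic"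
    by (rule E_conseq[OF that]) auto
  moreover have "Imp \<mu> (And \<phi> \<psi>) \<in> E_logic"
    if "Imp \<mu> \<phi> \<in> E_logic" "Imp \<mu> \<psi> \<in> E_logic"
    by (rule E_conseq2[OF that]) auto
  ultimately show ?case by blast
next
  case (Dia \<phi>)
  then obtain e where d: "d = Suc e" and \<phi>: "\<phi> \<in> Fms v e"
    by (cases d) (auto simp: Fms_def)
  \<comment> \<open>With \<open>\<phi>\<close> replaced by its DCF formula, the diamond becomes a
    modal factor whose sign \<open>\<mu>\<close> fixes; RE carries the decision back to
    \<open>Dia \<phi>\<close>.\<close>
  obtain \<phi>s where \<phi>s: "\<phi>s \<in> set (subseqs (minterm_list v e))" "\<phi> \<approx>\<^sub>E disj_list \<phi>s"
    by (rule equiv_disj_minterms[OF Dia.IH[OF \<phi>]])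
  let ?\<psi> = "Dia (disj_list \<phi>s)"
  have "?\<psi> \<in> set (mod_atoms v d)" using \<phi>s(1) d by simp
  then have "Imp \<mu> ?\<psi> \<in> E_logic \<or> Imp \<mu> (Neg ?\<psi>) \<in> E_logic"
    using mod_atom_decided Dia.prems(2) by blast
  moreover have eq: "Iff (Dia \<phi>) ?\<psi> \<in> E_logic"
    using fm_equiv_Dia[OF \<phi>s(2)] by (simp add: fm_equiv_def)
  have "Imp \<mu> (Dia \<phi>) \<in> E_logic" if "Imp \<mu> ?\<psi> \<in> E_logic"
    by (rule E_conseq2[OF that eq]) auto
  moreover have "Imp \<mu> (Neg (Dia \<phi>)) \<in> E_logic" if "Imp \<mu> (Neg ?\<psi>) \<in> E_logic"
    by (rule E_conseq2[OF that eq]) auto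
  ultimately show ?case by blast
qed

text \<open>Distinct minterms exclude each other, so their equivalence would make both
  refutable.\<close>

lemma minterm_equiv_imp_eq:
  assumes "\<mu> \<in> minterms v d" "\<nu> \<in> minterms v d" "\<mu> \<approx>\<^sub>E \<nu>"
  shows "\<mu> = \<nu>"
proof (rule ccontr)
  assume "\<mu> \<noteq> \<nu>"
  then have "\<not> (ptrue w \<mu> \<and> ptrue w \<nu>)" for w
    using minterm_exclusive[OF assms(1,2)] by blast
  then have "Neg \<mu> \<in> E_logic"
    using assms(3) unfolding fm_equiv_def by (elim E_conseq) simp
  then show False using minterm_consistent assms(1) by blast
qed

text \<open>Otherwise every minterm would imply \<open>Neg \<phi>\<close>, and since the minterms
  are exhaustive \<open>\<phi>\<close> would be refutable.\<close>

lemma consistent_implied_by_minterm: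
  assumes "\<phi> \<in> Fms v d" "Neg \<phi> \<notin> E_logic"
  shows "\<exists>\<nu>\<in>minterms v d. Imp \<nu> \<phi> \<in> E_logic"
proof (rule ccontr)
  assume "\<not> ?thesis"
  then have imp: "Imp \<nu> (Neg \<phi>) \<in> E_logic" if "\<nu> \<in> minterms v d" for \<nu>
    using that minterm_decides[OF assms(1)] by blast
  let ?A = "(\<lambda>\<nu>. Imp \<nu> (Neg \<phi>)) ` minterms v d"
  have "Neg \<phi> \<in> E_logic"
  proof (rule E_conseq_finite)
    show "finite ?A" by (simp add: finite_minterms)
    show "?A \<subseteq> E_logic" using imp by blast
    fix w assume *: "\<And>\<psi>. \<psi> \<in> ?A \<Longrightarrow> ptrue w \<psi>"
    obtain \<nu> where "\<nu> \<in> minterms v d" "ptrue w \<nu>" using minterm_exhaustive by blast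
    with *[of "Imp \<nu> (Neg \<phi>)"] show "ptrue w (Neg \<phi>)" by simp
  qed
  with assms(2) show False by blast
qed

section \<open>Mutually inverse substitutions\<close>

text \<open>Invertibility in the monoid of classes, expressed through representatives. The symmetry
  lets every result be used for the inverse as well.\<close>

definition inverse_tuples :: "nat \<Rightarrow> fm list \<Rightarrow> fm list \<Rightarrow> bool" where
  "inverse_tuples v \<sigma> \<tau> \<longleftrightarrow> \<sigma> \<in> subst_tuples v \<and> \<tau> \<in> subst_tuples v \<and>
    list_all2 (\<approx>\<^sub>E) (map (\<lambda>\<phi>. \<phi> \<circ>\<^sub>s \<tau>) \<sigma>) (map Var [0..<v]) \<and>
    list_all2 (\<approx>\<^sub>E) (map (\<lambda>\<phi>. \<phi> \<circ>\<^sub>s \<sigma>) \<tau>) (map Var [0..<v])"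

lemma inverse_tuples_sym: "inverse_tuples v \<sigma> \<tau> \<Longrightarrow> inverse_tuples v \<tau> \<sigma>"
  by (auto simp: inverse_tuples_def)

lemma prime_subst_inverse:
  assumes "S \<in> carrier (prime_subst_group v)" "\<sigma> \<in> S"
  obtains \<tau> where "inverse_tuples v \<sigma> \<tau>"
proof -
  have S: "S \<in> carrier (subst_monoid v)" and "\<exists>T\<in>carrier (subst_monoid v).
      T \<otimes>\<^bsub>subst_monoid v\<^esub> S = \<one>\<^bsub>subst_monoid v\<^esub> \<and> S \<otimes>\<^bsub>subst_monoid v\<^esub> T = \<one>\<^bsub>subst_monoid v\<^esub>"
    using assms(1) by (auto simp: prime_subst_group_def units_of_def Units_def)
  then obtain T where T: "T \<in> carrier (subst_monoid v)"
    "T \<otimes>\<^bsub>subst_monoid v\<^esub> S = \<one>\<^bsub>subst_monoid v\<^esub>" "S \<otimes>\<^bsub>subst_monoid v\<^esub> T = \<one>\<^bsub>subst_monoid v\<^esub>"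
    by blast
  obtain \<rho> where \<rho>: "\<rho> \<in> subst_tuples v" "S = subst_rel v `` {\<rho>}" using S by (rule subst_carrierE)
  obtain \<tau> where \<tau>: "\<tau> \<in> subst_tuples v" "T = subst_rel v `` {\<tau>}" using T(1) by (rule subst_carrierE)
  \<comment> \<open>The given \<open>\<sigma>\<close> replaces the representative
    \<open>\<rho>\<close>, so that the products of classes are computed from \<open>\<sigma>\<close>
    itself.\<close>
  have "(\<rho>, \<sigma>) \<in> subst_rel v" using assms(2) \<rho> by blast
  then have \<sigma>: "\<sigma> \<in> subst_tuples v" "S = subst_rel v `` {\<sigma>}"
    using \<rho>(2) equiv_class_eq[OF equiv_subst_rel] by (auto simp: subst_rel_def)
  have one: "\<one>\<^bsub>subst_monoid v\<^esub> = subst_rel v `` {map Var [0..<v]}"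
    by (simp add: subst_monoid_def)
  have "(map (\<lambda>\<phi>. \<phi> \<circ>\<^sub>s \<tau>) \<sigma>, map Var [0..<v]) \<in> subst_rel v"
    using T(3) unfolding \<sigma>(2) \<tau>(2) one subst_mult_class[OF \<sigma>(1) \<tau>(1)]
    by (rule eq_equiv_class[OF _ equiv_subst_rel subst_id_tuples])
  moreover have "(map (\<lambda>\<phi>. \<phi> \<circ>\<^sub>s \<sigma>) \<tau>, map Var [0..<v]) \<in> subst_rel v"
    using T(2) unfolding \<sigma>(2) \<tau>(2) one subst_mult_class[OF \<tau>(1) \<sigma>(1)]
    by (rule eq_equiv_class[OF _ equiv_subst_rel subst_id_tuples])
  ultimately show thesis
    using \<sigma>(1) \<tau>(1) by (intro that[of \<tau>]) (auto simp: inverse_tuples_def subst_rel_def)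
qed

text \<open>Two successive substitutions act as their composite, which is componentwise equivalent
  to the identity tuple.\<close>

lemma inverse_tuples_cancel:
  assumes "inverse_tuples v \<sigma> \<tau>" "\<phi> \<in> Fms v d"
  shows "\<phi> \<circ>\<^sub>s \<sigma> \<circ>\<^sub>s \<tau> \<approx>\<^sub>E \<phi>"
proof -
  have "\<phi> \<circ>\<^sub>s \<sigma> \<circ>\<^sub>s \<tau> = \<phi> \<circ>\<^sub>s map (\<lambda>\<psi>. \<psi> \<circ>\<^sub>s \<tau>) \<sigma>"
    using assms by (intro tup_subst_assoc) (auto simp: inverse_tuples_def subst_tuples_def Fms_def)
  also have "\<dots> \<approx>\<^sub>E \<phi> \<circ>\<^sub>s map Var [0..<v]"
    using assms(1) by (intro tup_subst_cong) (auto simp: inverse_tuples_def)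
  finally show ?thesis by (simp add: tup_subst_id)
qed

lemma tup_subst_E_logic: "\<phi> \<in> E_logic \<Longrightarrow> \<phi> \<circ>\<^sub>s \<sigma> \<in> E_logic"
  unfolding tup_subst_def by (rule E_logic.us)

lemma tup_subst_simps [simp]:
  "Neg \<phi> \<circ>\<^sub>s \<sigma> = Neg (\<phi> \<circ>\<^sub>s \<sigma>)"
  "Or \<phi> \<psi> \<circ>\<^sub>s \<sigma> = Or (\<phi> \<circ>\<^sub>s \<sigma>) (\<psi> \<circ>\<^sub>s \<sigma>)"
  "And \<phi> \<psi> \<circ>\<^sub>s \<sigma> = And (\<phi> \<circ>\<^sub>s \<sigma>) (\<psi> \<circ>\<^sub>s \<sigma>)"
  by (simp_all add: tup_subst_def)

text \<open>Substituting \<open>\<tau>\<close> into a refutation of the instance gives, after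
  cancellation, a refutation of \<open>\<phi>\<close>.\<close>

lemma inverse_tuples_consistent:
  assumes "inverse_tuples v \<sigma> \<tau>" "\<phi> \<in> Fms v d" "Neg \<phi> \<notin> E_logic"
  shows "Neg (\<phi> \<circ>\<^sub>s \<sigma>) \<notin> E_logic"
proof
  assume "Neg (\<phi> \<circ>\<^sub>s \<sigma>) \<in> E_logic"
  then have "Neg (\<phi> \<circ>\<^sub>s \<sigma> \<circ>\<^sub>s \<tau>) \<in> E_logic" using tup_subst_E_logic by fastforce
  then have "Neg \<phi> \<in> E_logic"
    using inverse_tuples_cancel[OF assms(1,2)] unfolding fm_equiv_def by (rule E_conseq2) auto
  with assms(3) show False by blast
qed

text \<open>Some minterm \<open>\<nu>\<close> implies the consistent formula
  \<open>\<mu> \<circ>\<^sub>s \<sigma>\<close>. The converse implication is obtained on the other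
  side of the inverse, where \<open>\<mu>\<close> is an atom, and carried back by
  \<open>\<sigma>\<close>.\<close>

lemma minterm_subst_equiv_minterm:
  assumes "inverse_tuples v \<sigma> \<tau>" "\<mu> \<in> minterms v d"
  shows "\<exists>\<nu>\<in>minterms v d. \<mu> \<circ>\<^sub>s \<sigma> \<approx>\<^sub>E \<nu>"
proof -
  note Fms = subsetD[OF minterms_Fms]
  have tup: "\<sigma> \<in> subst_tuples v" "\<tau> \<in> subst_tuples v" using assms(1) by (auto simp: inverse_tuples_def)
  note inv = inverse_tuples_sym[OF assms(1)]
  have "Neg (\<mu> \<circ>\<^sub>s \<sigma>) \<notin> E_logic"
    using inverse_tuples_consistent assms Fms minterm_consistent by blast
  then obtain \<nu> where \<nu>: "\<nu> \<in> minterms v d" "Imp \<nu> (\<mu> \<circ>\<^sub>s \<sigma>) \<in> E_logic"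
    using consistent_implied_by_minterm tup_subst_Fms[OF tup(1) Fms[OF assms(2)]] by blast
  \<comment> \<open>Apply the inverse: \<open>\<nu> \<circ> \<tau>\<close> is consistent and implies the atom \<open>\<mu>\<close>, so it is implied by \<open>\<mu>\<close>.\<close>
  have "Imp (\<nu> \<circ>\<^sub>s \<tau>) (\<mu> \<circ>\<^sub>s \<sigma> \<circ>\<^sub>s \<tau>) \<in> E_logic"
    using tup_subst_E_logic[OF \<nu>(2), of \<tau>] by simp
  then have le: "Imp (\<nu> \<circ>\<^sub>s \<tau>) \<mu> \<in> E_logic"
    using inverse_tuples_cancel[OF assms(1) Fms[OF assms(2)]] unfolding fm_equiv_def
    by (rule E_conseq2) auto
  have "Imp \<mu> (\<nu> \<circ>\<^sub>s \<tau>) \<in> E_logic"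
  proof (rule ccontr)
    assume "Imp \<mu> (\<nu> \<circ>\<^sub>s \<tau>) \<notin> E_logic"
    then have "Imp \<mu> (Neg (\<nu> \<circ>\<^sub>s \<tau>)) \<in> E_logic"
      using minterm_decides[OF tup_subst_Fms[OF tup(2) Fms[OF \<nu>(1)]] assms(2)] by blast
    with le have "Neg (\<nu> \<circ>\<^sub>s \<tau>) \<in> E_logic" by (rule E_conseq2) auto
    then show False
      using inverse_tuples_consistent[OF inv Fms[OF \<nu>(1)]] minterm_consistent[OF \<nu>(1)] by blast
  qed
  then have "Imp (\<mu> \<circ>\<^sub>s \<sigma>) (\<nu> \<circ>\<^sub>s \<tau> \<circ>\<^sub>s \<sigma>) \<in> E_logic"
    using tup_subst_E_logic[of "Imp \<mu> (\<nu> \<circ>\<^sub>s \<tau>)" \<sigma>] by simp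
  then have "Imp (\<mu> \<circ>\<^sub>s \<sigma>) \<nu> \<in> E_logic"
    using inverse_tuples_cancel[OF inv Fms[OF \<nu>(1)]] unfolding fm_equiv_def
    by (rule E_conseq2) auto
  with \<nu> show ?thesis by (auto simp: fm_equiv_iff_Imp)
qed

lemma minterm_subst_equiv_unique:
  assumes "inverse_tuples v \<sigma> \<tau>" "\<mu> \<in> minterms v d"
  shows "\<exists>!\<nu>. \<nu> \<in> minterms v d \<and> \<mu> \<circ>\<^sub>s \<sigma> \<approx>\<^sub>E \<nu>"
proof (rule ex_ex1I)
  show "\<exists>\<nu>. \<nu> \<in> minterms v d \<and> \<mu> \<circ>\<^sub>s \<sigma> \<approx>\<^sub>E \<nu>"
    using minterm_subst_equiv_minterm[OF assms] by blast
  show "\<nu> = \<nu>'" if "\<nu> \<in> minterms v d \<and> \<mu> \<circ>\<^sub>s \<sigma> \<approx>\<^sub>E \<nu>" "\<nu>' \<in> minterms v d \<and> \<mu> \<circ>\<^sub>s \<sigma> \<approx>\<^sub>E \<nu>'" for \<nu> \<nu>'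
    using that minterm_equiv_imp_eq fm_equiv_sym fm_equiv_trans by blast
qed

section \<open>The permutation of minterms\<close>

lemma minterm_map_props:
  assumes "inverse_tuples v \<sigma> \<tau>" "\<mu> \<in> minterms v d"
  shows "minterm_map v d \<sigma> \<mu> \<in> minterms v d" "\<mu> \<circ>\<^sub>s \<sigma> \<approx>\<^sub>E minterm_map v d \<sigma> \<mu>"
  using theI'[OF minterm_subst_equiv_unique[OF assms]] by (simp_all add: minterm_map_def)

text \<open>Both sides are minterms equivalent to
  \<open>\<mu> \<circ>\<^sub>s \<sigma> \<circ>\<^sub>s \<tau>\<close>, and equivalent minterms are
  equal.\<close>

lemma minterm_map_inverse:
  assumes "inverse_tuples v \<sigma> \<tau>" "\<mu> \<in> minterms v d"
  shows "minterm_map v d \<tau> (minterm_map v d \<sigma> \<mu>) = \<mu>"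
proof (rule minterm_equiv_imp_eq)
  let ?\<nu> = "minterm_map v d \<sigma> \<mu>"
  note \<nu> = minterm_map_props[OF assms]
  note \<mu>' = minterm_map_props[OF inverse_tuples_sym[OF assms(1)] \<nu>(1)]
  show "minterm_map v d \<tau> ?\<nu> \<in> minterms v d" by (rule \<mu>'(1))
  have "\<mu> \<circ>\<^sub>s \<sigma> \<circ>\<^sub>s \<tau> \<approx>\<^sub>E ?\<nu> \<circ>\<^sub>s \<tau>"
    using \<nu>(2) by (intro tup_subst_cong) (simp_all add: list_all2_refl)
  moreover have "\<mu> \<circ>\<^sub>s \<sigma> \<circ>\<^sub>s \<tau> \<approx>\<^sub>E \<mu>"
    using inverse_tuples_cancel assms minterms_Fms by blast
  ultimately show "minterm_map v d \<tau> ?\<nu> \<approx>\<^sub>E \<mu>"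
    using \<mu>'(2) fm_equiv_sym fm_equiv_trans by blast
qed (rule assms(2))

lemma bij_betw_minterm_map:
  assumes "inverse_tuples v \<sigma> \<tau>"
  shows "bij_betw (minterm_map v d \<sigma>) (minterms v d) (minterms v d)"
proof (rule bij_betw_byWitness[where f' = "minterm_map v d \<tau>"])
  note inv = inverse_tuples_sym[OF assms]
  show "\<forall>\<mu>\<in>minterms v d. minterm_map v d \<tau> (minterm_map v d \<sigma> \<mu>) = \<mu>"
    using minterm_map_inverse[OF assms] by blast
  show "\<forall>\<mu>\<in>minterms v d. minterm_map v d \<sigma> (minterm_map v d \<tau> \<mu>) = \<mu>"
    using minterm_map_inverse[OF inv] by blast
  show "minterm_map v d \<sigma> ` minterms v d \<subseteq> minterms v d"
    using minterm_map_props(1)[OF assms] by blast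
  show "minterm_map v d \<tau> ` minterms v d \<subseteq> minterms v d"
    using minterm_map_props(1)[OF inv] by blast
qed

section \<open>The automorphism of the lattice of classes\<close>

lemma class_map_fm_class:
  assumes "\<sigma> \<in> subst_tuples v" "\<phi> \<in> Fms v d"
  shows "class_map v d \<sigma> (fm_class v d \<phi>) = fm_class v d (\<phi> \<circ>\<^sub>s \<sigma>)"
proof -
  \<comment> \<open>All sets in the union defining \<open>class_map\<close> coincide, and the union
    is over a nonempty class, so it equals that common set.\<close>
  have "fm_class v d (\<psi> \<circ>\<^sub>s \<sigma>) = fm_class v d (\<phi> \<circ>\<^sub>s \<sigma>)" if "\<psi> \<in> fm_class v d \<phi>" for \<psi>
  proof -
    have "\<psi> \<in> Fms v d" "\<psi> \<approx>\<^sub>E \<phi>"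
      using that by (auto simp: fm_class_def Fms_rel_def intro: fm_equiv_sym)
    then show ?thesis
      using assms by (simp add: fm_class_eq_iff tup_subst_Fms tup_subst_cong list_all2_refl)
  qed
  moreover have "\<phi> \<in> fm_class v d \<phi>"
    using assms(2) by (simp add: fm_class_def Fms_rel_def)
  ultimately show ?thesis unfolding class_map_def by blast
qed

lemma class_map_closed:
  "\<lbrakk>\<sigma> \<in> subst_tuples v; A \<in> carrier (E_lattice v d)\<rbrakk> \<Longrightarrow> class_map v d \<sigma> A \<in> carrier (E_lattice v d)"
  by (elim E_carrierE) (simp add: class_map_fm_class tup_subst_Fms)

lemma class_map_inverse:
  assumes "inverse_tuples v \<sigma> \<tau>" "A \<in> carrier (E_lattice v d)"
  shows "class_map v d \<tau> (class_map v d \<sigma> A) = A"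
proof -
  obtain \<phi> where \<phi>: "\<phi> \<in> Fms v d" "A = fm_class v d \<phi>" using assms(2) by (rule E_carrierE)
  have "\<sigma> \<in> subst_tuples v" "\<tau> \<in> subst_tuples v" using assms(1) by (auto simp: inverse_tuples_def)
  with \<phi> show ?thesis
    by (simp add: class_map_fm_class tup_subst_Fms fm_class_eq_iff inverse_tuples_cancel[OF assms(1)])
qed

lemma lattice_automorphism_class_map:
  assumes "inverse_tuples v \<sigma> \<tau>"
  shows "lattice_automorphism (E_lattice v d) (class_map v d \<sigma>)"
proof -
  note inv = inverse_tuples_sym[OF assms]
  have tup: "\<sigma> \<in> subst_tuples v" "\<tau> \<in> subst_tuples v" using assms by (auto simp: inverse_tuples_def)
  let ?L = "E_lattice v d" and ?f = "class_map v d \<sigma>"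
  have "bij_betw ?f (carrier ?L) (carrier ?L)"
    using class_map_inverse[OF assms] class_map_inverse[OF inv] class_map_closed tup
    by (intro bij_betw_byWitness[where f' = "class_map v d \<tau>"]) auto
  \<comment> \<open>Joins and meets are classes of disjunctions and conjunctions, and substitution
    commutes with both connectives.\<close>
  moreover have "?f (A \<squnion>\<^bsub>?L\<^esub> B) = ?f A \<squnion>\<^bsub>?L\<^esub> ?f B" "?f (A \<sqinter>\<^bsub>?L\<^esub> B) = ?f A \<sqinter>\<^bsub>?L\<^esub> ?f B"
    if "A \<in> carrier ?L" "B \<in> carrier ?L" for A B
  proof -
    obtain \<phi> \<psi> where "\<phi> \<in> Fms v d" "A = fm_class v d \<phi>" "\<psi> \<in> Fms v d" "B = fm_class v d \<psi>"
      using \<open>A \<in> carrier ?L\<close> \<open>B \<in> carrier ?L\<close> by (elim E_carrierE) blast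
    then show "?f (A \<squnion>\<^bsub>?L\<^esub> B) = ?f A \<squnion>\<^bsub>?L\<^esub> ?f B" "?f (A \<sqinter>\<^bsub>?L\<^esub> B) = ?f A \<sqinter>\<^bsub>?L\<^esub> ?f B"
      using tup(1) by (simp_all add: join_E_lattice meet_E_lattice class_map_fm_class tup_subst_Fms
          Fms_Or Fms_And)
  qed
  then have "join_pres ?L ?L ?f" "meet_pres ?L ?L ?f"
    by (simp_all add: join_pres_def meet_pres_def lattice_E_lattice)
  ultimately show ?thesis by (simp add: lattice_automorphism_def)
qed

theorem theorem4:
  fixes v d :: nat and S :: "fm list set" and \<sigma> :: "fm list"
  assumes "S \<in> carrier (prime_subst_group v)"
    and "\<sigma> \<in> S"
  shows "((\<forall>\<mu>\<in>minterms v d. \<exists>!\<nu>. \<nu> \<in> minterms v d \<and> \<mu> \<circ>\<^sub>s \<sigma> \<approx>\<^sub>E \<nu>) \<and>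
      bij_betw (minterm_map v d \<sigma>) (minterms v d) (minterms v d)) \<and>
    ((\<forall>\<phi>\<in>Fms v d. \<phi> \<circ>\<^sub>s \<sigma> \<in> Fms v d \<and>
        class_map v d \<sigma> (fm_class v d \<phi>) = fm_class v d (\<phi> \<circ>\<^sub>s \<sigma>)) \<and>
      lattice_automorphism (E_lattice v d) (class_map v d \<sigma>))"
proof -
  obtain \<tau> where inv: "inverse_tuples v \<sigma> \<tau>" using assms by (rule prime_subst_inverse)
  then have "\<sigma> \<in> subst_tuples v" by (simp add: inverse_tuples_def)
  with inv show ?thesis
    by (simp add: minterm_subst_equiv_unique bij_betw_minterm_map tup_subst_Fms class_map_fm_class
        lattice_automorphism_class_map)
qed

end
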